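(* Let $\Delta=\{(t,\tau)\in\mathbb{R}^2: a\le\tau<t\le b\}$ and $\alpha:\Delta\to(0,1)$. If $\frac1n<\alpha(t,\tau)<1$ for all $(t,\tau)\in\Delta$ and a certain $n\in\mathbb{N}$ greater than or equal to two, and $f,g\in C([a,b];\mathbb{R})$, then $$\int_a^b g(t)\;{}_{a}I^{\alpha(\cdot,\cdot)}_{t}f(t)\,dt=\int_a^b f(t)\;{}_{t}I^{\alpha(\cdot,\cdot)}_{b}g(t)\,dt .$$
   Context: Here $a<b$ are real numbers and $\Gamma$ is the Gamma function. For an order function $\alpha:\Delta\to(0,1)$ and $f\in L_1[a,b]$, the left and right Riemann--Liouville integrals of variable fractional order $\alpha(\cdot,\cdot)$ are defined by $${}_{a}I^{\alpha(\cdot,\cdot)}_{t}f(t)=\int_a^t\frac{1}{\Gamma(\alpha(t,\tau))}(t-\tau)^{\alpha(t,\tau)-1}f(\tau)\,d\tau,\quad t>a,$$ $${}_{t}I^{\alpha(\cdot,\cdot)}_{b}f(t)=\int_t^b\frac{1}{\Gamma(\alpha(\tau,t))}(\tau-t)^{\alpha(\tau,t)-1}f(\tau)\,d\tau,\quad t<b.$$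
   Formalization: The order function α is additionally assumed to be Lebesgue measurable on Δ; for an arbitrary α: Δ→(0,1) the fractional integrals in the identity need not be defined. *)

theory Defs
  imports "HOL-Analysis.Analysis"
begin

definition Delta :: "real \<Rightarrow> real \<Rightarrow> (real \<times> real) set" where
  "Delta a b = {(t, \<tau>). a \<le> \<tau> \<and> \<tau> < t \<and> t \<le> b}"

definition rl_kernel :: "(real \<times> real \<Rightarrow> real) \<Rightarrow> real \<Rightarrow> real \<Rightarrow> real" where
  "rl_kernel \<alpha> t \<tau> = 1 / Gamma (\<alpha> (t, \<tau>)) * (t - \<tau>) powr (\<alpha> (t, \<tau>) - 1)"

text \<open>
  The domains of integration are half-open so that the order function is evaluated on
  \<^const>\<open>Delta\<close> only. In the right integral the integration variable is the first
  argument of the kernel.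
\<close>

definition left_rl_integral ::
    "real \<Rightarrow> (real \<times> real \<Rightarrow> real) \<Rightarrow> (real \<Rightarrow> real) \<Rightarrow> real \<Rightarrow> real" where
  "left_rl_integral a \<alpha> f t = (LINT \<tau>:{a..<t}|lebesgue. rl_kernel \<alpha> t \<tau> * f \<tau>)"

definition right_rl_integral ::
    "real \<Rightarrow> (real \<times> real \<Rightarrow> real) \<Rightarrow> (real \<Rightarrow> real) \<Rightarrow> real \<Rightarrow> real" where
  "right_rl_integral b \<alpha> f t = (LINT \<tau>:{t<..b}|lebesgue. rl_kernel \<alpha> \<tau> t * f \<tau>)"

end

theory Submission
  imports Defs
begin

text \<open>
  Both sides of the identity are iterated integrals of
  \<open>rl_kernel \<alpha> t \<tau> * f \<tau> * g t\<close> over the triangle \<open>Delta a b\<close>, in the two possible orders,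
  so the theorem is Fubini's theorem once this function is known to be integrable on the plane.

  Integrability is where the lower bound \<open>1 / n\<close> on the order enters. Since \<open>1 / Gamma\<close> extends
  continuously to \<open>[0, 1]\<close>, the Gamma factor is bounded by a constant \<open>C\<close>; and for orders between
  \<open>c = 1 / n\<close> and \<open>1\<close> the power is at most \<open>s powr (c - 1)\<close> when \<open>s = t - \<tau>\<close> is at most \<open>1\<close>, and at
  most \<open>1\<close> otherwise. Hence the kernel is dominated by \<open>C * (1 + (t - \<tau>) powr (c - 1))\<close>, a function
  of the difference alone whose singularity is integrable because \<open>c - 1 > - 1\<close>
  (\<open>rl_kernel_bound\<close>, \<open>integrable_rl_kernel\<close>). The continuous factors \<open>f\<close> and \<open>g\<close> are bounded.

  The order function is only Lebesgue measurable, so in general the integrand is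
  measurable only for the completion of the product measure. The Fubini theorem needed here
  (\<open>lebesgue_Fubini\<close>) therefore goes through a Borel representative: the two functions agree
  off a Borel null set, almost every slice of which is null. Applied to the kernel times \<open>f\<close>
  and to the kernel times \<open>g\<close>, it also yields the existence of the two fractional integrals at
  almost every point.
\<close>

section \<open>Fubini's theorem for Lebesgue measurable functions\<close>

text \<open>
  Transfers integrability from a representative measurable for \<open>M\<close>; completeness is what
  makes \<open>f\<close> measurable at all.
\<close>

lemma AE_eq_integrable_completion:
  fixes f g :: "'a \<Rightarrow> 'b::{banach, second_countable_topology}"
  assumes g: "integrable M g" and eq: "AE x in M. f x = g x"
  shows "integrable (completion M) f" "integral\<^sup>L (completion M) f = integral\<^sup>L M g"
proof -
  have gm: "g \<in> borel_measurable (completion M)"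
    using g by (intro measurable_completion) auto
  have eq': "AE x in completion M. f x = g x"
    using eq by (rule AE_completion)
  have fm: "f \<in> borel_measurable (completion M)"
  proof (rule measurableI)
    fix B :: "'b set" assume B: "B \<in> sets borel"
    show "f -` B \<inter> space (completion M) \<in> sets (completion M)"
    proof (rule completion.in_sets_AE)
      show "g -` B \<inter> space (completion M) \<in> sets (completion M)"
        using gm B by (rule measurable_sets)
      show "AE x in completion M. x \<in> g -` B \<inter> space (completion M)
              \<longleftrightarrow> x \<in> f -` B \<inter> space (completion M)"
        using eq' by eventually_elim auto
    qed auto
  qed auto
  have gi: "integrable (completion M) g"
    using g by (simp add: integrable_completion)
  show "integrable (completion M) f"
    using integrable_cong_AE[OF fm gm eq'] gi by blast
  show "integral\<^sup>L (completion M) f = integral\<^sup>L M g"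
    using integral_cong_AE[OF fm gm eq'] g by (simp add: integral_completion)
qed

text \<open>
  Lebesgue measure on the product space is the completion of the product of the factors, so \<open>F\<close>
  need not be measurable for that product, and some of its slices may fail to be measurable. Replacing it by a Borel function changes almost every slice only on a
  null set, which neither integrability nor the integrals notice.
\<close>

lemma lebesgue_Fubini:
  fixes F :: "'a::euclidean_space \<times> 'b::euclidean_space \<Rightarrow> real"
  assumes F: "integrable lebesgue F"
  shows "AE x in lebesgue. integrable lebesgue (\<lambda>y. F (x, y))"
    and "AE y in lebesgue. integrable lebesgue (\<lambda>x. F (x, y))"
    and "integrable lebesgue (\<lambda>x. LINT y|lebesgue. F (x, y))"
    and "integrable lebesgue (\<lambda>y. LINT x|lebesgue. F (x, y))"
    and "(LINT x|lebesgue. LINT y|lebesgue. F (x, y)) = (LINT y|lebesgue. LINT x|lebesgue. F (x, y))"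
proof -
  obtain G where G: "G \<in> borel_measurable lborel" "AE z in lborel. F z = G z"
    using completion_ex_borel_measurable_real[OF borel_measurable_integrable[OF F]] by auto
  obtain N where N: "N \<in> null_sets lborel" "{z. F z \<noteq> G z} \<subseteq> N"
    using G(2) unfolding eventually_ae_filter by auto
  have "integrable lebesgue G"
    using integrable_cong_AE[OF borel_measurable_integrable[OF F] measurable_completion[OF G(1)]
        AE_completion[OF G(2)]] F by blast
  then have iG: "integrable (lborel \<Otimes>\<^sub>M lborel) (\<lambda>(x, y). G (x, y))"
    using G(1) by (simp add: lborel_prod integrable_completion)
  \<comment> \<open>The exceptional set must be enlarged to a Borel null set before slicing it.\<close>
  have "AE z in lborel \<Otimes>\<^sub>M lborel. z \<notin> N"
    using AE_not_in[OF N(1)] unfolding lborel_prod .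
  then have AE1: "AE x in lborel. AE y in lborel. (x, y) \<notin> N"
    by (rule lborel_pair.AE_pair)
  have "N \<in> sets (lborel \<Otimes>\<^sub>M lborel)"
    using N(1) unfolding lborel_prod by auto
  then have "{z \<in> space (lborel \<Otimes>\<^sub>M lborel). (fst z, snd z) \<notin> N} \<in> sets (lborel \<Otimes>\<^sub>M lborel)"
    by measurable
  then have AE2: "AE y in lborel. AE x in lborel. (x, y) \<notin> N"
    using AE1 lborel_pair.AE_commute[of "\<lambda>x y. (x, y) \<notin> N"] by blast
  have eq: "F z = G z" if "z \<notin> N" for z
    using N(2) that by auto
  have slice1: "AE x in lborel. integrable lebesgue (\<lambda>y. F (x, y)) \<and>
      (LINT y|lebesgue. F (x, y)) = (LINT y|lborel. G (x, y))"
    using lborel_pair.AE_integrable_fst[OF iG] AE1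
  proof eventually_elim
    case (elim x)
    from elim(2) have "AE y in lborel. F (x, y) = G (x, y)"
      by eventually_elim (rule eq)
    from AE_eq_integrable_completion[OF elim(1) this] show ?case by blast
  qed
  have slice2: "AE y in lborel. integrable lebesgue (\<lambda>x. F (x, y)) \<and>
      (LINT x|lebesgue. F (x, y)) = (LINT x|lborel. G (x, y))"
    using lborel_pair.AE_integrable_snd[OF iG] AE2
  proof eventually_elim
    case (elim y)
    from elim(2) have "AE x in lborel. F (x, y) = G (x, y)"
      by eventually_elim (rule eq)
    from AE_eq_integrable_completion[OF elim(1) this] show ?case by blast
  qed
  have "AE x in lborel. integrable lebesgue (\<lambda>y. F (x, y))"
    using slice1 by eventually_elim blast
  then show "AE x in lebesgue. integrable lebesgue (\<lambda>y. F (x, y))"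
    by (rule AE_completion)
  have "AE y in lborel. integrable lebesgue (\<lambda>x. F (x, y))"
    using slice2 by eventually_elim blast
  then show "AE y in lebesgue. integrable lebesgue (\<lambda>x. F (x, y))"
    by (rule AE_completion)
  have "AE x in lborel. (LINT y|lebesgue. F (x, y)) = (LINT y|lborel. G (x, y))"
    using slice1 by eventually_elim blast
  note int1 = AE_eq_integrable_completion[OF lborel_pair.integrable_fst[OF iG] this]
  have "AE y in lborel. (LINT x|lebesgue. F (x, y)) = (LINT x|lborel. G (x, y))"
    using slice2 by eventually_elim blast
  note int2 = AE_eq_integrable_completion[OF lborel_pair.integrable_snd[OF iG] this]
  show "integrable lebesgue (\<lambda>x. LINT y|lebesgue. F (x, y))"
    by (rule int1(1))
  show "integrable lebesgue (\<lambda>y. LINT x|lebesgue. F (x, y))"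
    by (rule int2(1))
  show "(LINT x|lebesgue. LINT y|lebesgue. F (x, y)) = (LINT y|lebesgue. LINT x|lebesgue. F (x, y))"
    using int1(2) int2(2) lborel_pair.Fubini_integral[OF iG] by simp
qed

section \<open>Integrability of the kernel\<close>

lemma rGamma_bounded_on_unit_interval:
  obtains C :: real where "C > 0" "\<And>x::real. 0 \<le> x \<Longrightarrow> x \<le> 1 \<Longrightarrow> \<bar>rGamma x\<bar> \<le> C"
proof -
  have "compact (rGamma ` {0..1::real})"
    by (intro compact_continuous_image continuous_intros) auto
  then obtain C where "C > 0" "\<forall>y\<in>rGamma ` {0..1::real}. norm y \<le> C"
    using compact_imp_bounded bounded_pos by metis
  then show ?thesis by (intro that[of C]) auto
qed

text \<open>
  For exponents varying in \<open>[c - 1, 0]\<close> a power of \<open>s\<close> is largest at the left end when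
  \<open>s \<le> 1\<close> and at the right end when \<open>s > 1\<close>; the sum of the two extreme powers covers both cases
  and no longer depends on the order function.
\<close>

lemma rl_kernel_bound:
  assumes "0 < c" and rG: "\<And>x. 0 \<le> x \<Longrightarrow> x \<le> 1 \<Longrightarrow> \<bar>rGamma x\<bar> \<le> C"
    and "c \<le> \<alpha> (t, \<tau>)" "\<alpha> (t, \<tau>) \<le> 1" "\<tau> < t"
  shows "\<bar>rl_kernel \<alpha> t \<tau>\<bar> \<le> C * (1 + (t - \<tau>) powr (c - 1))"
proof -
  let ?s = "t - \<tau>" and ?e = "\<alpha> (t, \<tau>)"
  have "?s powr (?e - 1) \<le> 1 + ?s powr (c - 1)"
  proof (cases "?s \<le> 1")
    case True
    then have "?s powr (?e - 1) \<le> ?s powr (c - 1)"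
      using assms by (intro powr_mono') auto
    then show ?thesis by simp
  next
    case False
    then have "?s powr (?e - 1) \<le> ?s powr 0"
      using assms by (intro powr_mono) auto
    with False show ?thesis
      using powr_ge_zero[of ?s "c - 1"] by (simp del: powr_ge_zero)
  qed
  then have "\<bar>rGamma ?e\<bar> * ?s powr (?e - 1) \<le> C * (1 + ?s powr (c - 1))"
    using rG[of ?e] assms order_trans[OF abs_ge_zero rG[of ?e]] by (intro mult_mono) auto
  then show ?thesis
    by (simp add: rl_kernel_def rGamma_inverse_Gamma abs_mult divide_inverse)
qed

lemma integrable_powr_truncated:
  fixes c L :: real
  assumes "0 < c" "0 \<le> L"
  shows "integrable lborel (\<lambda>s. indicator {0<..L} s * (1 + s powr (c - 1)))"
proof -
  have "(\<lambda>s. 1 + s powr (c - 1)) integrable_on {0<..L}"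
    using assms by (intro integrable_add integrable_on_powr_from_0')
      (auto intro!: integrable_on_const fmeasurableI)
  then have "set_integrable lebesgue {0<..L} (\<lambda>s. 1 + s powr (c - 1))"
    by (intro nonnegative_absolutely_integrable_1) (auto intro: add_nonneg_nonneg)
  then have "integrable lebesgue (\<lambda>s. indicator {0<..L} s * (1 + s powr (c - 1)))"
    by (simp add: set_integrable_def)
  then show ?thesis
    by (subst (asm) integrable_completion) measurable
qed

text \<open>
  The majorant of the kernel has this shape. By translation and reflection invariance, the inner
  integral is the integral of \<open>k\<close> for every \<open>t\<close> in the strip, so only the width of the strip matters.
\<close>

lemma integrable_strip_convolution:
  fixes k :: "real \<Rightarrow> real"
  assumes k: "integrable lborel k"
  shows "integrable lebesgue (\<lambda>(t, \<tau>). indicator {a..b} t * k (t - \<tau>))"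
proof -
  have [measurable]: "k \<in> borel_measurable borel"
    using borel_measurable_integrable[OF k] by simp
  have refl_shift: "integrable lborel (\<lambda>\<tau>. h (t - \<tau>))"
      "(LINT \<tau>|lborel. h (t - \<tau>)) = (LINT s|lborel. h s)"
    if "integrable lborel h" for h :: "real \<Rightarrow> real" and t
    using that lborel_integrable_real_affine[of h "-1" t]
      lborel_integral_real_affine[of "-1" h t] by simp_all
  have "integrable (lborel \<Otimes>\<^sub>M lborel) (\<lambda>(t, \<tau>). indicator {a..b} t * k (t - \<tau>))"
  proof (rule lborel_pair.Fubini_integrable)
    show "(\<lambda>(t, \<tau>). indicator {a..b} t * k (t - \<tau>)) \<in> borel_measurable (lborel \<Otimes>\<^sub>M lborel)"
      by measurable
    have "(LINT \<tau>|lborel. norm (case (t, \<tau>) of (t, \<tau>) \<Rightarrow> indicator {a..b} t * k (t - \<tau>)))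
        = indicator {a..b} t * (LINT s|lborel. norm (k s))" for t
      using refl_shift(2)[of "\<lambda>s. norm (k s)" t] k by (simp add: abs_mult)
    then have "(\<lambda>t. LINT \<tau>|lborel.
          norm (case (t, \<tau>) of (t, \<tau>) \<Rightarrow> indicator {a..b} t * k (t - \<tau>)))
        = (\<lambda>t. indicator {a..b} t * (LINT s|lborel. norm (k s)))"
      by (rule ext)
    then show "integrable lborel (\<lambda>t. LINT \<tau>|lborel.
        norm (case (t, \<tau>) of (t, \<tau>) \<Rightarrow> indicator {a..b} t * k (t - \<tau>)))"
      using integrable_real_indicator[of "{a..b}" lborel] by (simp add: emeasure_lborel_Icc_eq)
    show "AE t in lborel. integrable lborel
        (\<lambda>\<tau>. case (t, \<tau>) of (t, \<tau>) \<Rightarrow> indicator {a..b} t * k (t - \<tau>))"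
      using refl_shift(1)[OF k] by auto
  qed
  then show ?thesis
    by (subst integrable_completion) (auto simp: lborel_prod)
qed

lemma Delta_borel: "Delta a b \<in> sets borel"
proof -
  have "Delta a b = {z. a \<le> snd z} \<inter> {z. snd z < fst z} \<inter> {z. fst z \<le> b}"
    by (auto simp: Delta_def)
  also have "\<dots> \<in> sets borel"
    by (intro sets.Int borel_closed borel_open closed_Collect_le open_Collect_less continuous_intros)
  finally show ?thesis .
qed

text \<open>
  Extending the kernel by zero outside the triangle lets one function on the plane serve both
  orders of integration.
\<close>

lemma integrable_rl_kernel:
  fixes c :: real
  assumes "0 < c" and ord: "\<And>z. z \<in> Delta a b \<Longrightarrow> c \<le> \<alpha> z \<and> \<alpha> z \<le> 1"
    and meas: "\<alpha> \<in> borel_measurable (lebesgue_on (Delta a b))"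
  shows "integrable lebesgue (\<lambda>(t, \<tau>). if (t, \<tau>) \<in> Delta a b then rl_kernel \<alpha> t \<tau> else 0)"
proof (cases "a \<le> b")
  case True
  obtain C :: real where C: "C > 0" "\<And>x::real. 0 \<le> x \<Longrightarrow> x \<le> 1 \<Longrightarrow> \<bar>rGamma x\<bar> \<le> C"
    by (rule rGamma_bounded_on_unit_interval) auto
  define k :: "real \<Rightarrow> real" where "k s = indicator {0<..b - a} s * (1 + s powr (c - 1))" for s
  have k: "integrable lborel k"
    unfolding k_def using assms(1) True by (intro integrable_powr_truncated) auto
  show ?thesis
  proof (rule Bochner_Integration.integrable_bound)
    show "integrable lebesgue (\<lambda>z. C * (case z of (t, \<tau>) \<Rightarrow> indicator {a..b} t * k (t - \<tau>)))"
      by (intro integrable_mult_right integrable_strip_convolution k)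
    have rG: "(rGamma :: real \<Rightarrow> real) \<in> borel_measurable borel"
      by (intro borel_measurable_continuous_onI continuous_intros)
    have diff: "(\<lambda>z. fst z - snd z :: real) \<in> borel_measurable (lebesgue_on (Delta a b))"
      by (intro measurable_restrict_space1 measurable_completion) 
        (auto intro!: borel_measurable_continuous_onI continuous_intros)
    have "(\<lambda>z. rGamma (\<alpha> z) * (fst z - snd z) powr (\<alpha> z - 1))
        \<in> borel_measurable (lebesgue_on (Delta a b))"
      using measurable_compose[OF meas rG] diff meas by measurable
    then have "(\<lambda>z. if z \<in> Delta a b then rGamma (\<alpha> z) * (fst z - snd z) powr (\<alpha> z - 1) else 0)
        \<in> borel_measurable lebesgue"
      using Delta_borel by (intro borel_measurable_if_I) auto
    then show "(\<lambda>(t, \<tau>). if (t, \<tau>) \<in> Delta a b then rl_kernel \<alpha> t \<tau> else 0)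
        \<in> borel_measurable lebesgue"
      by (simp add: rl_kernel_def rGamma_inverse_Gamma inverse_eq_divide case_prod_beta' cong: if_cong)
    have "norm (case z of (t, \<tau>) \<Rightarrow> if (t, \<tau>) \<in> Delta a b then rl_kernel \<alpha> t \<tau> else 0)
        \<le> norm (C * (case z of (t, \<tau>) \<Rightarrow> indicator {a..b} t * k (t - \<tau>)))" for z
    proof (cases z)
      case (Pair t \<tau>)
      show ?thesis
      proof (cases "z \<in> Delta a b")
        case True
        then have "k (t - \<tau>) = 1 + (t - \<tau>) powr (c - 1)" "t \<in> {a..b}" "\<tau> < t"
          using Pair by (auto simp: Delta_def k_def)
        moreover have "\<bar>rl_kernel \<alpha> t \<tau>\<bar> \<le> C * (1 + (t - \<tau>) powr (c - 1))"
          using True Pair ord[of z] assms(1) C(2) \<open>\<tau> < t\<close> by (intro rl_kernel_bound) auto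
        ultimately show ?thesis
          using True Pair C(1) powr_ge_zero[of "t - \<tau>" "c - 1"] by (simp add: abs_mult)
      qed (simp add: Pair)
    qed
    then show "AE z in lebesgue.
        norm (case z of (t, \<tau>) \<Rightarrow> if (t, \<tau>) \<in> Delta a b then rl_kernel \<alpha> t \<tau> else 0)
        \<le> norm (C * (case z of (t, \<tau>) \<Rightarrow> indicator {a..b} t * k (t - \<tau>)))"
      by simp
  qed
next
  case False
  then have "Delta a b = {}" by (auto simp: Delta_def)
  then show ?thesis by (simp add: case_prod_beta')
qed

section \<open>Integration by parts\<close>

lemma continuous_truncation_borel_bounded:
  fixes f :: "real \<Rightarrow> real"
  assumes "continuous_on {a..b} f"
  shows "(\<lambda>x. indicator {a..b} x * f x) \<in> borel_measurable borel"
    and "\<exists>B. \<forall>x. \<bar>indicator {a..b} x * f x\<bar> \<le> B"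
proof -
  show "(\<lambda>x. indicator {a..b} x * f x) \<in> borel_measurable borel"
    using borel_measurable_continuous_on_indicator[OF _ assms] by simp
  have "compact (f ` {a..b})"
    using assms by (intro compact_continuous_image) auto
  then obtain B where "B > 0" "\<forall>y\<in>f ` {a..b}. norm y \<le> B"
    using compact_imp_bounded bounded_pos by metis
  then show "\<exists>B. \<forall>x. \<bar>indicator {a..b} x * f x\<bar> \<le> B"
    by (intro exI[of _ B]) (auto simp: indicator_def)
qed

lemma integrable_mult_bounded_borel:
  fixes K w :: "'a::euclidean_space \<Rightarrow> real"
  assumes K: "integrable lebesgue K" and w: "w \<in> borel_measurable borel" "\<And>z. \<bar>w z\<bar> \<le> B"
  shows "integrable lebesgue (\<lambda>z. K z * w z)"
proof (rule Bochner_Integration.integrable_bound)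
  show "integrable lebesgue (\<lambda>z. B * K z)" using K by simp
  have "w \<in> borel_measurable lebesgue" using w(1) by (intro measurable_completion) auto
  then show "(\<lambda>z. K z * w z) \<in> borel_measurable lebesgue"
    using borel_measurable_integrable[OF K] by simp
  have "\<bar>K z\<bar> * \<bar>w z\<bar> \<le> \<bar>K z\<bar> * \<bar>B\<bar>" for z
    using w(2)[of z] by (intro mult_left_mono) auto
  then show "AE z in lebesgue. norm (K z * w z) \<le> norm (B * K z)"
    by (simp add: abs_mult mult.commute)
qed

theorem theorem2:
  fixes a b :: real and \<alpha> :: "real \<times> real \<Rightarrow> real" and n :: nat and f g :: "real \<Rightarrow> real"
  assumes "a < b"
    and "\<alpha> \<in> Delta a b \<rightarrow> {0<..<1}"
    and "\<alpha> \<in> borel_measurable (lebesgue_on (Delta a b))"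
    and "n \<ge> 2"
    and "\<forall>(t, \<tau>) \<in> Delta a b. 1 / real n < \<alpha> (t, \<tau>) \<and> \<alpha> (t, \<tau>) < 1"
    and "continuous_on {a..b} f"
    and "continuous_on {a..b} g"
  shows "(AE t in lebesgue. t \<in> {a..b} \<longrightarrow>
            set_integrable lebesgue {a..<t} (\<lambda>\<tau>. rl_kernel \<alpha> t \<tau> * f \<tau>))
       \<and> (AE t in lebesgue. t \<in> {a..b} \<longrightarrow>
            set_integrable lebesgue {t<..b} (\<lambda>\<tau>. rl_kernel \<alpha> \<tau> t * g \<tau>))
       \<and> set_integrable lebesgue {a..b} (\<lambda>t. g t * left_rl_integral a \<alpha> f t)
       \<and> set_integrable lebesgue {a..b} (\<lambda>t. f t * right_rl_integral b \<alpha> g t)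
       \<and> (LINT t:{a..b}|lebesgue. g t * left_rl_integral a \<alpha> f t)
         = (LINT t:{a..b}|lebesgue. f t * right_rl_integral b \<alpha> g t)"
proof -
  define K where "K = (\<lambda>(t, \<tau>). if (t, \<tau>) \<in> Delta a b then rl_kernel \<alpha> t \<tau> else 0)"
  define f0 g0 where "f0 x = indicator {a..b} x * f x" and "g0 x = indicator {a..b} x * g x" for x
  have K: "integrable lebesgue K"
    unfolding K_def using assms by (intro integrable_rl_kernel[of "1 / real n"]) (auto dest!: bspec)
  obtain A where A: "f0 \<in> borel_measurable borel" "\<And>x. \<bar>f0 x\<bar> \<le> A"
    using continuous_truncation_borel_bounded[OF \<open>continuous_on {a..b} f\<close>] unfolding f0_def by blast
  obtain B where B: "g0 \<in> borel_measurable borel" "\<And>x. \<bar>g0 x\<bar> \<le> B"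
    using continuous_truncation_borel_bounded[OF \<open>continuous_on {a..b} g\<close>] unfolding g0_def by blast
  have fs: "fst \<in> borel_measurable (borel :: (real \<times> real) measure)"
      "snd \<in> borel_measurable (borel :: (real \<times> real) measure)"
    by (intro borel_measurable_continuous_onI continuous_intros)+
  have f_snd: "(\<lambda>z. f0 (snd z)) \<in> borel_measurable (borel :: (real \<times> real) measure)"
    using fs(2) A(1) by (rule measurable_compose)
  have g_fst: "(\<lambda>z. g0 (fst z)) \<in> borel_measurable (borel :: (real \<times> real) measure)"
    using fs(1) B(1) by (rule measurable_compose)
  have Kf: "integrable lebesgue (\<lambda>z. K z * f0 (snd z))"
    by (rule integrable_mult_bounded_borel[OF K f_snd A(2)])
  have Kg: "integrable lebesgue (\<lambda>z. K z * g0 (fst z))"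
    by (rule integrable_mult_bounded_borel[OF K g_fst B(2)])
  have Kfg: "integrable lebesgue (\<lambda>z. K z * f0 (snd z) * g0 (fst z))"
    by (rule integrable_mult_bounded_borel[OF Kf g_fst B(2)])
  \<comment> \<open>Fixing one coordinate at \<open>t\<close>, the triangle cuts out exactly the domain of each fractional integral;
      the half-open ends match.\<close>
  have left_slice: "K (t, \<tau>) * f0 \<tau> = indicator {a..<t} \<tau> *\<^sub>R (rl_kernel \<alpha> t \<tau> * f \<tau>)"
    if "t \<in> {a..b}" for t \<tau>
    using that by (auto simp: K_def Delta_def f0_def indicator_def)
  have right_slice: "K (\<tau>, t) * g0 \<tau> = indicator {t<..b} \<tau> *\<^sub>R (rl_kernel \<alpha> \<tau> t * g \<tau>)"
    if "t \<in> {a..b}" for t \<tau>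
    using that by (auto simp: K_def Delta_def g0_def indicator_def)
  have left: "(LINT \<tau>|lebesgue. K (t, \<tau>) * f0 \<tau> * g0 t)
      = indicator {a..b} t *\<^sub>R (g t * left_rl_integral a \<alpha> f t)" for t
  proof (cases "t \<in> {a..b}")
    case True
    then show ?thesis
      by (simp add: left_slice left_rl_integral_def set_lebesgue_integral_def g0_def)
  qed (simp add: g0_def)
  have right: "(LINT t|lebesgue. K (t, \<tau>) * f0 \<tau> * g0 t)
      = indicator {a..b} \<tau> *\<^sub>R (f \<tau> * right_rl_integral b \<alpha> g \<tau>)" for \<tau>
  proof (cases "\<tau> \<in> {a..b}")
    case True
    have "(LINT t|lebesgue. K (t, \<tau>) * f0 \<tau> * g0 t) = (LINT t|lebesgue. f \<tau> * (K (t, \<tau>) * g0 t))"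
      using True by (simp add: f0_def mult_ac)
    also have "\<dots> = f \<tau> * right_rl_integral b \<alpha> g \<tau>"
      using True by (simp add: right_slice right_rl_integral_def set_lebesgue_integral_def)
    finally show ?thesis using True by simp
  qed (simp add: f0_def)
  show ?thesis
  proof (intro conjI)
    show "AE t in lebesgue. t \<in> {a..b} \<longrightarrow>
        set_integrable lebesgue {a..<t} (\<lambda>\<tau>. rl_kernel \<alpha> t \<tau> * f \<tau>)"
      using lebesgue_Fubini(1)[OF Kf]
      by eventually_elim (auto simp: left_slice set_integrable_def simp del: real_scaleR_def)
    show "AE t in lebesgue. t \<in> {a..b} \<longrightarrow>
        set_integrable lebesgue {t<..b} (\<lambda>\<tau>. rl_kernel \<alpha> \<tau> t * g \<tau>)"
      using lebesgue_Fubini(2)[OF Kg]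
      by eventually_elim (auto simp: right_slice set_integrable_def simp del: real_scaleR_def)
    show "set_integrable lebesgue {a..b} (\<lambda>t. g t * left_rl_integral a \<alpha> f t)"
      using lebesgue_Fubini(3)[OF Kfg] by (simp only: fst_conv snd_conv left set_integrable_def)
    show "set_integrable lebesgue {a..b} (\<lambda>t. f t * right_rl_integral b \<alpha> g t)"
      using lebesgue_Fubini(4)[OF Kfg] by (simp only: fst_conv snd_conv right set_integrable_def)
    show "(LINT t:{a..b}|lebesgue. g t * left_rl_integral a \<alpha> f t)
        = (LINT t:{a..b}|lebesgue. f t * right_rl_integral b \<alpha> g t)"
      using lebesgue_Fubini(5)[OF Kfg] by (simp only: fst_conv snd_conv left right set_lebesgue_integral_def)
  qed
qed

end
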